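(* Suppose $X$ has right-continuous paths. Then the following assertions are equivalent: (i) $X$ is free of arbitrage with simple strategies (i.e. no simple strategy is an arbitrage). (ii) $X$ satisfies (NOA), and there is no $0$-admissible arbitrage of the form $H\mathbf{1}_{(\sigma,\tau]}$ with bounded stopping times $\sigma\le\tau$ and an $\mathcal{F}_\sigma$-measurable direction $H$.
   Context: Setting: $(\Omega,\mathcal{F},(\mathcal{F}_t)_{t\in[0,\infty)},P)$ is a filtered probability space satisfying the usual conditions (completeness and right-continuity), and $X=(X_t)_{t\in[0,\infty)}$ is an $(\mathcal{F}_t)$-adapted $\mathbb{R}^D$-valued process (column vectors) modelling $D$ discounted stocks; there is also a constant bond $B_t=1$. All stopping times are with respect to $(\mathcal{F}_t)$. Simple strategy: $\Phi_t=\phi_0\mathbf{1}_{\{0\}}(t)+\sum_{j=0}^{n-1}\phi_j\mathbf{1}_{(\tau_j,\tau_{j+1}]}(t)$, where $n\in\mathbb{N}$, $0=\tau_0\le\tau_1\le\cdots\le\tau_n$ are a.s. finite stopping times and each $\phi_j$ is a $D$-dimensional row vector of $\mathcal{F}_{\tau_j}$-measurable (real) random variables. Its wealth process with initial capital $v$ is $V_t(\Phi;v)=v+\sum_{j=0}^{n-1}\phi_j(X_{t\wedge\tau_{j+1}}-X_{t\wedge\tau_j})$ for $t\in[0,\infty)$, and $V_\infty(\Phi;v)=\lim_{t\to\infty}V_t(\Phi;v)=v+\sum_{j=0}^{n-1}\phi_j(X_{\tau_{j+1}}-X_{\tau_j})$. A simple strategy $\Phi$ is an arbitrage (simple arbitrage)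 if $V_\infty(\Phi;0)\ge0$ $P$-a.s. and $P(V_\infty(\Phi;0)>0)>0$; it is $0$-admissible if $\inf_{t\in[0,\infty)}V_t(\Phi;0)\ge0$ $P$-a.s. For a stopping time $\sigma$, an $\mathcal{F}_\sigma$-measurable direction is a $D$-dimensional row vector $H$ of $\mathcal{F}_\sigma$-measurable random variables with $|H|=1$ $P$-a.s. (Euclidean norm). (NOA), no obvious arbitrage: for every ($[0,\infty]$-valued) stopping time $\sigma$ with $P(\sigma<\infty)>0$, every $\varepsilon>0$ and every $\mathcal{F}_\sigma$-measurable direction $H$, $P\big(\{\sigma<\infty\}\cap\{\sup_{t\in[\sigma,\infty)}H(X_t-X_\sigma)<\varepsilon\}\big)>0$. *)

theory Defs
  imports "HOL-Probability.Probability"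
begin

text \<open>
  Only the times \<open>t \<ge> 0\<close> matter: \<open>F t\<close> and \<open>X t\<close> are unconstrained and never
  used for \<open>t < 0\<close>.
\<close>

locale usual_filtered_prob_space = prob_space M + complete_measure M
  for M :: "'a measure" +
  fixes F :: "real \<Rightarrow> 'a measure"
  assumes subalgebra_F: "\<And>t. 0 \<le> t \<Longrightarrow> subalgebra M (F t)"
    and F_mono: "\<And>s t. 0 \<le> s \<Longrightarrow> s \<le> t \<Longrightarrow> sets (F s) \<subseteq> sets (F t)"
    and null_sets_F: "null_sets M \<subseteq> sets (F 0)"
    and F_right_cont: "\<And>t. 0 \<le> t \<Longrightarrow> sets (F t) = (\<Inter>s\<in>{t<..}. sets (F s))"

locale stock_model = usual_filtered_prob_space M F
  for M :: "'a measure" and F :: "real \<Rightarrow> 'a measure" +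
  fixes X :: "real \<Rightarrow> 'a \<Rightarrow> real ^ 'd"
  assumes X_adapted: "\<And>t. 0 \<le> t \<Longrightarrow> X t \<in> borel_measurable (F t)"

definition right_continuous_paths :: "'a measure \<Rightarrow> (real \<Rightarrow> 'a \<Rightarrow> real ^ 'd) \<Rightarrow> bool" where
  "right_continuous_paths M X \<longleftrightarrow>
     (\<forall>\<omega>\<in>space M. \<forall>t\<ge>0. continuous (at_right t) (\<lambda>s. X s \<omega>))"

text \<open>
  The filtration is extended to the index set \<open>[0,\<infinity>]\<close> by the full sigma-algebra at
  \<open>\<infinity>\<close>, so that the library's \<^const>\<open>stopping_time\<close> and \<^const>\<open>filtration.pre_sigma\<close>
  apply to \<open>[0,\<infinity>]\<close>-valued times; a set \<open>A\<close> is then in the sigma-algebra of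
  \<open>\<sigma>\<close> iff \<open>A \<in> sets M\<close> and \<open>A \<inter> {\<sigma> \<le> t} \<in> sets (F t)\<close> for all finite \<open>t \<ge> 0\<close>
  (see \<open>sets_sigma_at\<close> below).
\<close>

definition ext_filtration :: "'a measure \<Rightarrow> (real \<Rightarrow> 'a measure) \<Rightarrow> ennreal \<Rightarrow> 'a measure" where
  "ext_filtration M F t = (if t = \<infinity> then M else F (enn2real t))"

abbreviation stop_time :: "'a measure \<Rightarrow> (real \<Rightarrow> 'a measure) \<Rightarrow> ('a \<Rightarrow> ennreal) \<Rightarrow> bool" where
  "stop_time M F \<sigma> \<equiv> stopping_time (ext_filtration M F) \<sigma>"

abbreviation sigma_at :: "'a measure \<Rightarrow> (real \<Rightarrow> 'a measure) \<Rightarrow> ('a \<Rightarrow> ennreal) \<Rightarrow> 'a measure" where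
  "sigma_at M F \<sigma> \<equiv> filtration.pre_sigma (space M) (ext_filtration M F) \<sigma>"

definition bounded_time :: "'a measure \<Rightarrow> ('a \<Rightarrow> ennreal) \<Rightarrow> bool" where
  "bounded_time M \<sigma> \<longleftrightarrow> (\<exists>c::real. \<forall>\<omega>\<in>space M. \<sigma> \<omega> \<le> ennreal c)"

definition direction ::
  "'a measure \<Rightarrow> (real \<Rightarrow> 'a measure) \<Rightarrow> ('a \<Rightarrow> ennreal) \<Rightarrow> ('a \<Rightarrow> real ^ 'd) \<Rightarrow> bool" where
  "direction M F \<sigma> H \<longleftrightarrow>
     H \<in> borel_measurable (sigma_at M F \<sigma>) \<and> (AE \<omega> in M. norm (H \<omega>) = 1)"

text \<open>
  A simple strategy is carried by the data \<open>n\<close>, \<open>\<tau>\<^sub>0, \<dots>, \<tau>\<^sub>n\<close> and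
  \<open>\<phi>\<^sub>0, \<dots>, \<phi>\<^sub>n\<^sub>-\<^sub>1\<close> of its representation; the associated process is \<open>position\<close>.
  Later entries of the two sequences are irrelevant. The product of a row vector of
  holdings and a column vector of prices is the inner product.
\<close>

record ('a, 'd::finite) strategy =
  steps :: nat
  times :: "nat \<Rightarrow> 'a \<Rightarrow> ennreal"
  holdings :: "nat \<Rightarrow> 'a \<Rightarrow> real ^ 'd"

definition simple_strategy ::
  "'a measure \<Rightarrow> (real \<Rightarrow> 'a measure) \<Rightarrow> ('a, 'd::finite) strategy \<Rightarrow> bool" where
  "simple_strategy M F S \<longleftrightarrow>
     0 < steps S \<and>
     (\<forall>j\<le>steps S. stop_time M F (times S j) \<and> (AE \<omega> in M. times S j \<omega> < \<infinity>)) \<and>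
     (\<forall>\<omega>\<in>space M. times S 0 \<omega> = 0) \<and>
     (\<forall>j<steps S. \<forall>\<omega>\<in>space M. times S j \<omega> \<le> times S (Suc j) \<omega>) \<and>
     (\<forall>j<steps S. holdings S j \<in> borel_measurable (sigma_at M F (times S j)))"

definition position :: "('a, 'd::finite) strategy \<Rightarrow> real \<Rightarrow> 'a \<Rightarrow> real ^ 'd" where
  "position S t \<omega> =
     indicator {0} t *\<^sub>R holdings S 0 \<omega> +
     (\<Sum>j<steps S. indicator {times S j \<omega> <.. times S (Suc j) \<omega>} (ennreal t) *\<^sub>R holdings S j \<omega>)"

definition stopped_at ::
  "(real \<Rightarrow> 'a \<Rightarrow> real ^ 'd) \<Rightarrow> ('a \<Rightarrow> ennreal) \<Rightarrow> real \<Rightarrow> 'a \<Rightarrow> real ^ 'd" where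
  "stopped_at X \<tau> t \<omega> = X (enn2real (min (ennreal t) (\<tau> \<omega>))) \<omega>"

definition wealth ::
  "(real \<Rightarrow> 'a \<Rightarrow> real ^ 'd) \<Rightarrow> ('a, 'd::finite) strategy \<Rightarrow> real \<Rightarrow> real \<Rightarrow> 'a \<Rightarrow> real" where
  "wealth X S v t \<omega> =
     v + (\<Sum>j<steps S. holdings S j \<omega> \<bullet>
           (stopped_at X (times S (Suc j)) t \<omega> - stopped_at X (times S j) t \<omega>))"

text \<open>
  The limit exists wherever all trading times are finite, hence almost surely for a
  simple strategy (see \<open>AE_terminal_wealth_eq\<close> below).
\<close>

definition terminal_wealth ::
  "(real \<Rightarrow> 'a \<Rightarrow> real ^ 'd) \<Rightarrow> ('a, 'd::finite) strategy \<Rightarrow> real \<Rightarrow> 'a \<Rightarrow> real" where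
  "terminal_wealth X S v \<omega> = Lim at_top (\<lambda>t. wealth X S v t \<omega>)"

definition arbitrage ::
  "'a measure \<Rightarrow> (real \<Rightarrow> 'a \<Rightarrow> real ^ 'd) \<Rightarrow> ('a, 'd::finite) strategy \<Rightarrow> bool" where
  "arbitrage M X S \<longleftrightarrow>
     (AE \<omega> in M. 0 \<le> terminal_wealth X S 0 \<omega>) \<and>
     0 < measure M {\<omega>\<in>space M. 0 < terminal_wealth X S 0 \<omega>}"

definition zero_admissible ::
  "'a measure \<Rightarrow> (real \<Rightarrow> 'a \<Rightarrow> real ^ 'd) \<Rightarrow> ('a, 'd::finite) strategy \<Rightarrow> bool" where
  "zero_admissible M X S \<longleftrightarrow> (AE \<omega> in M. 0 \<le> (INF t\<in>{0..}. ereal (wealth X S 0 t \<omega>)))"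

definition no_obvious_arbitrage ::
  "'a measure \<Rightarrow> (real \<Rightarrow> 'a measure) \<Rightarrow> (real \<Rightarrow> 'a \<Rightarrow> real ^ 'd) \<Rightarrow> bool" where
  "no_obvious_arbitrage M F X \<longleftrightarrow>
     (\<forall>\<sigma> \<epsilon> H. stop_time M F \<sigma> \<longrightarrow> 0 < measure M {\<omega>\<in>space M. \<sigma> \<omega> < \<infinity>} \<longrightarrow>
        0 < (\<epsilon>::real) \<longrightarrow> direction M F \<sigma> H \<longrightarrow>
        0 < measure M {\<omega>\<in>space M. \<sigma> \<omega> < \<infinity> \<and>
              (SUP t\<in>{enn2real (\<sigma> \<omega>)..}. ereal (H \<omega> \<bullet> (X t \<omega> - X (enn2real (\<sigma> \<omega>)) \<omega>)))
                < ereal \<epsilon>})"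

text \<open>The process of \<open>S\<close> is \<open>H 1\<^bsub>(\<sigma>,\<tau>]\<^esub>\<close>.\<close>

definition has_form ::
  "'a measure \<Rightarrow> ('a, 'd::finite) strategy \<Rightarrow> ('a \<Rightarrow> real ^ 'd) \<Rightarrow> ('a \<Rightarrow> ennreal) \<Rightarrow> ('a \<Rightarrow> ennreal) \<Rightarrow> bool"
  where
  "has_form M S H \<sigma> \<tau> \<longleftrightarrow>
     (\<forall>\<omega>\<in>space M. \<forall>t\<ge>0. position S t \<omega> = indicator {\<sigma> \<omega> <.. \<tau> \<omega>} (ennreal t) *\<^sub>R H \<omega>)"

lemma (in usual_filtered_prob_space) filtration_ext:
  "filtration (space M) (ext_filtration M F)"
proof
  show "space (ext_filtration M F i) = space M" for i
    using subalgebra_F[of "enn2real i"] by (simp add: ext_filtration_def subalgebra_def)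
  show "sets (ext_filtration M F i) \<subseteq> sets (ext_filtration M F j)" if "i \<le> j" for i j
  proof (cases "j = \<infinity>")
    case True
    then show ?thesis
      using subalgebra_F[of "enn2real i"] by (simp add: ext_filtration_def subalgebra_def)
  next
    case False
    with that have "i \<noteq> \<infinity>" "enn2real i \<le> enn2real j"
      by (auto intro!: enn2real_mono simp: top.not_eq_extremum top_unique)
    with False show ?thesis
      by (simp add: ext_filtration_def F_mono)
  qed
qed

lemma (in usual_filtered_prob_space) sets_sigma_at:
  assumes "stop_time M F \<sigma>"
  shows "sets (sigma_at M F \<sigma>) =
    {A \<in> sets M. \<forall>t\<ge>0. {\<omega>\<in>A. \<sigma> \<omega> \<le> ennreal t} \<in> sets (F t)}" (is "_ = ?R")
proof -
  have "(\<forall>t. {\<omega>\<in>A. \<sigma> \<omega> \<le> t} \<in> sets (ext_filtration M F t)) \<longleftrightarrow> A \<in> ?R" for A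
  proof
    assume *: "\<forall>t. {\<omega>\<in>A. \<sigma> \<omega> \<le> t} \<in> sets (ext_filtration M F t)"
    have "A \<in> sets M"
      using *[rule_format, of \<infinity>] by (simp add: ext_filtration_def)
    moreover have "{\<omega>\<in>A. \<sigma> \<omega> \<le> ennreal t} \<in> sets (F t)" if "0 \<le> t" for t
      using *[rule_format, of "ennreal t"] that by (simp add: ext_filtration_def)
    ultimately show "A \<in> ?R" by simp
  next
    assume *: "A \<in> ?R"
    show "\<forall>t. {\<omega>\<in>A. \<sigma> \<omega> \<le> t} \<in> sets (ext_filtration M F t)"
    proof
      fix t show "{\<omega>\<in>A. \<sigma> \<omega> \<le> t} \<in> sets (ext_filtration M F t)"
        using * by (cases t rule: ennreal_cases) (auto simp: ext_filtration_def)
    qed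
  qed
  then show ?thesis
    unfolding filtration.sets_pre_sigma[OF filtration_ext assms] by blast
qed

lemma terminal_wealth_eq:
  assumes "\<forall>j\<le>steps S. times S j \<omega> < \<infinity>"
  shows "((\<lambda>t. wealth X S v t \<omega>) \<longlongrightarrow> terminal_wealth X S v \<omega>) at_top"
    and "terminal_wealth X S v \<omega> = v + (\<Sum>j<steps S. holdings S j \<omega> \<bullet>
           (X (enn2real (times S (Suc j) \<omega>)) \<omega> - X (enn2real (times S j \<omega>)) \<omega>))" (is "_ = ?r")
proof -
  have ev: "eventually (\<lambda>t. stopped_at X (times S j) t \<omega> = X (enn2real (times S j \<omega>)) \<omega>) at_top"
    if "j \<le> steps S" for j
    using eventually_ge_at_top[of "enn2real (times S j \<omega>)"]
  proof eventually_elim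
    case (elim t)
    then have "times S j \<omega> \<le> ennreal t"
      using assms that by (metis ennreal_enn2real ennreal_leI infinity_ennreal_def)
    then show ?case by (simp add: stopped_at_def min_absorb2)
  qed
  have "eventually (\<lambda>t. \<forall>j\<in>{..steps S}.
      stopped_at X (times S j) t \<omega> = X (enn2real (times S j \<omega>)) \<omega>) at_top"
    by (rule eventually_ball_finite) (auto intro: ev)
  then have "eventually (\<lambda>t. wealth X S v t \<omega> = ?r) at_top"
    by eventually_elim (auto simp: wealth_def intro!: sum.cong)
  then have lim: "((\<lambda>t. wealth X S v t \<omega>) \<longlongrightarrow> ?r) at_top"
    by (rule tendsto_eventually)
  then show eq: "terminal_wealth X S v \<omega> = ?r"
    unfolding terminal_wealth_def by (intro tendsto_Lim) auto
  show "((\<lambda>t. wealth X S v t \<omega>) \<longlongrightarrow> terminal_wealth X S v \<omega>) at_top"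
    using lim unfolding eq .
qed

lemma AE_terminal_wealth_eq:
  assumes "simple_strategy M F S"
  shows "AE \<omega> in M. terminal_wealth X S v \<omega> = v + (\<Sum>j<steps S. holdings S j \<omega> \<bullet>
           (X (enn2real (times S (Suc j) \<omega>)) \<omega> - X (enn2real (times S j \<omega>)) \<omega>))"
proof -
  have "AE \<omega> in M. \<forall>j\<in>{..steps S}. times S j \<omega> < \<infinity>"
    using assms by (intro AE_finite_allI) (auto simp: simple_strategy_def)
  then show ?thesis
    by eventually_elim (rule terminal_wealth_eq(2), auto)
qed

end

theory Submission
  imports Defs
begin

text \<open>
  If (NOA) fails for \<open>\<sigma>\<close>, \<open>H\<close> and \<open>\<epsilon>\<close>, hold \<open>H\<close> from \<open>\<sigma>\<close> until the gain first exceeds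
  \<open>\<epsilon>/2\<close>; restricted to \<open>{\<sigma> \<le> n}\<close>, this is an arbitrage for large \<open>n\<close>. Conversely,
  take the first trading date at which the gain of a simple arbitrage is almost surely
  nonnegative and not almost surely zero. Trading only in the period before that date, and only
  if the gain so far is not positive, is still an arbitrage, and its holdings can be normalised
  to a direction. By (NOA) the gain of such a one-period arbitrage cannot fall below zero during
  the period, since by its end a loss would surely be recovered. Nonnegativity along
  the path allows the trading times to be truncated at a large deterministic time.
\<close>

section \<open>Stopping times with values in [0,\<infinity>] and their sigma-algebras\<close>

sublocale usual_filtered_prob_space \<subseteq> ext: filtration "space M" "ext_filtration M F"
  by (rule filtration_ext)

context usual_filtered_prob_space
begin

lemma sets_sigma_at_le: "stop_time M F \<sigma> \<Longrightarrow> sets (sigma_at M F \<sigma>) \<subseteq> sets M"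
  by (auto simp: sets_sigma_at)

lemma measurable_sigma_atD: "stop_time M F \<sigma> \<Longrightarrow> f \<in> sigma_at M F \<sigma> \<rightarrow>\<^sub>M N \<Longrightarrow> f \<in> M \<rightarrow>\<^sub>M N"
  using measurable_mono[OF order_refl refl sets_sigma_at_le ext.space_pre_sigma] by blast

lemma measurable_sigma_at_mono:
  assumes "stop_time M F \<sigma>" "stop_time M F \<tau>" "\<And>\<omega>. \<omega> \<in> space M \<Longrightarrow> \<sigma> \<omega> \<le> \<tau> \<omega>"
    and "f \<in> sigma_at M F \<sigma> \<rightarrow>\<^sub>M N"
  shows "f \<in> sigma_at M F \<tau> \<rightarrow>\<^sub>M N"
  using measurable_mono[OF order_refl refl ext.mono_pre_sigma[OF assms(1-3)]] assms(4)
  by (auto simp: ext.space_pre_sigma)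

lemma stop_time_measurable: "stop_time M F \<sigma> \<Longrightarrow> \<sigma> \<in> borel_measurable M"
  using measurable_sigma_atD ext.measurable_stopping_time_pre_sigma by blast

text \<open>Right-continuity of the filtration turns strict inequalities into weak ones:
  \<open>{\<rho> \<le> r}\<close> is the intersection of the events \<open>{\<rho> < a n}\<close>
  with \<open>a n\<close> decreasing to \<open>r\<close> inside \<open>(r, s]\<close>, so it lies in
  \<open>F s\<close> for every \<open>s > r\<close>. This form suits first passage times, whose
  strict events are countable unions.\<close>

lemma stop_timeI_less:
  assumes less: "\<And>r. 0 < r \<Longrightarrow> {\<omega>\<in>space M. \<rho> \<omega> < ennreal r} \<in> sets (F r)"
  shows "stop_time M F \<rho>"
proof (rule stopping_timeI)
  fix t :: ennreal
  show "Measurable.pred (ext_filtration M F t) (\<lambda>\<omega>. \<rho> \<omega> \<le> t)"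
  proof (cases t rule: ennreal_cases)
    case (real r)
    have "{\<omega>\<in>space M. \<rho> \<omega> \<le> ennreal r} \<in> sets (F s)" if "r < s" for s
    proof -
      define a where "a n = r + (s - r) / Suc n" for n :: nat
      have a: "r < a n" "a n \<le> s" for n
        using that mult_right_mono[of r s "real n"] by (auto simp: a_def field_simps)
      have "a \<longlonglongrightarrow> r + 0"
        unfolding a_def by (intro tendsto_intros LIMSEQ_Suc lim_const_over_n)
      then have lim: "(\<lambda>n. ennreal (a n)) \<longlonglongrightarrow> ennreal r"
        by (intro tendsto_ennrealI) simp
      have "{\<omega>\<in>space M. \<rho> \<omega> \<le> ennreal r} = (\<Inter>n. {\<omega>\<in>space M. \<rho> \<omega> < ennreal (a n)})"
      proof safe
        fix \<omega> n assume "\<rho> \<omega> \<le> ennreal r"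
        also have "\<dots> < ennreal (a n)"
          using real a(1)[of n] by (simp add: ennreal_less_iff)
        finally show "\<rho> \<omega> < ennreal (a n)" .
      next
        fix \<omega> assume "\<omega> \<in> (\<Inter>n. {\<omega>\<in>space M. \<rho> \<omega> < ennreal (a n)})"
        then show "\<rho> \<omega> \<le> ennreal r"
          by (intro LIMSEQ_le_const[OF lim]) (auto intro: less_imp_le)
      qed auto
      also have "\<dots> \<in> sets (F s)"
      proof -
        have "{\<omega>\<in>space M. \<rho> \<omega> < ennreal (a n)} \<in> sets (F s)" for n
          using less[of "a n"] F_mono[of "a n" s] a[of n] real by auto
        then show ?thesis by (intro sets.countable_INT) auto
      qed
      finally show ?thesis .
    qed
    then have "{\<omega>\<in>space M. \<rho> \<omega> \<le> ennreal r} \<in> sets (F r)"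
      using F_right_cont[of r] real by auto
    moreover have "space (F r) = space M"
      using subalgebra_F[of r] real by (simp add: subalgebra_def)
    ultimately show ?thesis
      using real by (simp add: pred_def ext_filtration_def)
  qed simp
qed

text \<open>Since \<open>\<sigma> \<le> \<tau>\<^sub>1\<close>, the event
  \<open>A \<inter> {\<tau>\<^sub>1 \<le> t}\<close> equals \<open>(A \<inter> {\<sigma> \<le> t})
  \<inter> {\<tau>\<^sub>1 \<le> t}\<close>, whose two factors are known at time \<open>t\<close>;
  the complement of \<open>A\<close> is treated in the same way with
  \<open>\<tau>\<^sub>2\<close>.\<close>

lemma stop_time_if:
  assumes \<sigma>: "stop_time M F \<sigma>" and A: "A \<in> sets (sigma_at M F \<sigma>)"
    and \<tau>: "stop_time M F \<tau>\<^sub>1" "stop_time M F \<tau>\<^sub>2"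
    and le: "\<And>\<omega>. \<omega> \<in> space M \<Longrightarrow> \<sigma> \<omega> \<le> \<tau>\<^sub>1 \<omega>" "\<And>\<omega>. \<omega> \<in> space M \<Longrightarrow> \<sigma> \<omega> \<le> \<tau>\<^sub>2 \<omega>"
  shows "stop_time M F (\<lambda>\<omega>. if \<omega> \<in> A then \<tau>\<^sub>1 \<omega> else \<tau>\<^sub>2 \<omega>)"
proof (rule stopping_timeI)
  fix t
  have Asp: "A \<subseteq> space M"
    using sets.sets_into_space[OF A] by (simp add: ext.space_pre_sigma)
  have A': "space M - A \<in> sets (sigma_at M F \<sigma>)"
    using sets.compl_sets[OF A] by (simp add: ext.space_pre_sigma)
  have "({\<omega>\<in>A. \<sigma> \<omega> \<le> t} \<inter> {\<omega>\<in>space M. \<tau>\<^sub>1 \<omega> \<le> t}) \<union>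
      ({\<omega>\<in>space M - A. \<sigma> \<omega> \<le> t} \<inter> {\<omega>\<in>space M. \<tau>\<^sub>2 \<omega> \<le> t}) \<in> sets (ext_filtration M F t)" (is "?U \<in> _")
    using stopping_timeD[OF \<tau>(1), of t] stopping_timeD[OF \<tau>(2), of t]
    by (intro sets.Un sets.Int ext.sets_pre_sigmaD[OF \<sigma>] A A') (simp_all add: pred_def ext.space_F)
  also have "?U = {\<omega>\<in>space M. (if \<omega> \<in> A then \<tau>\<^sub>1 \<omega> else \<tau>\<^sub>2 \<omega>) \<le> t}"
    using Asp le by (auto intro: order_trans)
  finally show "Measurable.pred (ext_filtration M F t) (\<lambda>\<omega>. (if \<omega> \<in> A then \<tau>\<^sub>1 \<omega> else \<tau>\<^sub>2 \<omega>) \<le> t)"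
    by (simp add: pred_def ext.space_F)
qed

text \<open>Used to truncate trading dates at a fixed time \<open>c\<close>. Whether
  \<open>\<sigma> \<le> c\<close> is known at \<open>c\<close>, so a constant can be held from
  \<open>c\<close> on where this fails. The constant \<open>e\<close> is left free: 0 means no
  position, a unit vector keeps the result a direction.\<close>

lemma measurable_sigma_at_min_const:
  fixes H :: "'a \<Rightarrow> 'b::topological_space"
  assumes \<sigma>: "stop_time M F \<sigma>" and H: "H \<in> borel_measurable (sigma_at M F \<sigma>)"
  shows "(\<lambda>\<omega>. if \<sigma> \<omega> \<le> c then H \<omega> else e) \<in> borel_measurable (sigma_at M F (\<lambda>\<omega>. min (\<sigma> \<omega>) c))"
proof (rule measurableI)
  fix B :: "'b set" assume B: "B \<in> sets borel"
  let ?f = "\<lambda>\<omega>. if \<sigma> \<omega> \<le> c then H \<omega> else e"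
  have HB: "{\<omega>\<in>{\<omega>\<in>space M. H \<omega> \<in> B}. \<sigma> \<omega> \<le> t} \<in> sets (ext_filtration M F t)" for t
    using ext.sets_pre_sigmaD[OF \<sigma> measurable_sets[OF H B], of t]
    by (simp add: ext.space_pre_sigma vimage_def Int_def conj_commute)
  have "{\<omega>\<in>{\<omega>\<in>space M. ?f \<omega> \<in> B}. min (\<sigma> \<omega>) c \<le> t} \<in> sets (ext_filtration M F t)" for t
  proof (cases "c \<le> t")
    case True
    have "{\<omega>\<in>space M. \<not> \<sigma> \<omega> \<le> c \<and> e \<in> B} \<in> sets (ext_filtration M F c)"
      using stopping_timeD2[OF \<sigma>, of c] by (cases "e \<in> B") (simp_all add: pred_def ext.space_F not_le)
    then have "{\<omega>\<in>{\<omega>\<in>space M. H \<omega> \<in> B}. \<sigma> \<omega> \<le> c} \<union> {\<omega>\<in>space M. \<not> \<sigma> \<omega> \<le> c \<and> e \<in> B}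
        \<in> sets (ext_filtration M F c)"
      using HB by blast
    also have "{\<omega>\<in>{\<omega>\<in>space M. H \<omega> \<in> B}. \<sigma> \<omega> \<le> c} \<union> {\<omega>\<in>space M. \<not> \<sigma> \<omega> \<le> c \<and> e \<in> B}
        = {\<omega>\<in>{\<omega>\<in>space M. ?f \<omega> \<in> B}. min (\<sigma> \<omega>) c \<le> t}"
      using True by (auto simp: min_le_iff_disj)
    finally show ?thesis
      by (rule subsetD[OF ext.sets_F_mono[OF True]])
  next
    case False
    then have "{\<omega>\<in>{\<omega>\<in>space M. ?f \<omega> \<in> B}. min (\<sigma> \<omega>) c \<le> t} = {\<omega>\<in>{\<omega>\<in>space M. H \<omega> \<in> B}. \<sigma> \<omega> \<le> t}"
      by (auto simp: min_le_iff_disj split: if_splits)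
    with HB[of t] show ?thesis by simp
  qed
  then have "{\<omega>\<in>space M. ?f \<omega> \<in> B} \<in> sets (sigma_at M F (\<lambda>\<omega>. min (\<sigma> \<omega>) c))"
    by (intro ext.sets_pre_sigmaI stopping_time_min stopping_time_const \<sigma>)
  then show "?f -` B \<inter> space (sigma_at M F (\<lambda>\<omega>. min (\<sigma> \<omega>) c)) \<in> sets (sigma_at M F (\<lambda>\<omega>. min (\<sigma> \<omega>) c))"
    by (simp add: ext.space_pre_sigma vimage_def Int_def conj_commute)
qed simp

end

section \<open>The price process observed at stopping times\<close>

locale rc_stock_model = stock_model M F X
  for M :: "'a measure" and F :: "real \<Rightarrow> 'a measure" and X :: "real \<Rightarrow> 'a \<Rightarrow> real ^ 'd" +
  assumes right_cont: "right_continuous_paths M X"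
begin

abbreviation X_at :: "('a \<Rightarrow> ennreal) \<Rightarrow> 'a \<Rightarrow> real ^ 'd" where
  "X_at \<sigma> \<omega> \<equiv> X (enn2real (\<sigma> \<omega>)) \<omega>"

lemma X_adapted_ext: "X (enn2real t) \<in> borel_measurable (ext_filtration M F t)"
proof (cases "t = \<infinity>")
  case True
  then show ?thesis
    using measurable_from_subalg[OF subalgebra_F X_adapted, of 0] by (simp add: ext_filtration_def)
next
  case False
  then show ?thesis
    using X_adapted[of "enn2real t"] by (simp add: ext_filtration_def)
qed

text \<open>Progressive measurability: \<open>\<sigma>\<close> is approximated from the right by times with countably
  many values.\<close>

lemma X_stopped_measurable:
  assumes \<sigma>: "stop_time M F \<sigma>"
  shows "(\<lambda>\<omega>. X (enn2real (min (\<sigma> \<omega>) t)) \<omega>) \<in> borel_measurable (ext_filtration M F t)"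
proof (rule borel_measurable_LIMSEQ_metric)
  \<comment> \<open>On the grid of mesh \<open>1 / Suc n\<close>, \<open>a n (k n \<omega>)\<close>
    is the first point strictly to the right of \<open>\<sigma> \<omega>\<close> when
    \<open>\<sigma> \<omega> < t\<close>; the \<open>+ 1\<close> in \<open>a\<close> makes the
    inequality strict, as a right-hand limit requires.\<close>
  define k where "k n \<omega> = nat \<lfloor>real (Suc n) * enn2real (min (\<sigma> \<omega>) t)\<rfloor>" for n \<omega>
  define a where "a n i = (real i + 1) / real (Suc n)" for n i :: nat
  let ?G = "ext_filtration M F t"
  \<comment> \<open>Grid points are capped at \<open>t\<close> so that only prices known at time
    \<open>t\<close> occur.\<close>
  define u where "u n \<omega> = (if \<sigma> \<omega> < t then X (enn2real (min t (ennreal (a n (k n \<omega>))))) \<omega>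
      else X (enn2real t) \<omega>)" for n \<omega>
  have [measurable]: "(\<lambda>\<omega>. min (\<sigma> \<omega>) t) \<in> borel_measurable ?G"
  proof (rule borel_measurableI_le)
    fix y
    show "{\<omega>\<in>space ?G. min (\<sigma> \<omega>) t \<le> y} \<in> sets ?G"
    proof (cases "t \<le> y")
      case False
      then show ?thesis
        using ext.stopping_time_le_const[OF \<sigma>, of y t] by (simp add: pred_def min_le_iff_disj)
    qed (simp add: min_le_iff_disj)
  qed
  have k[measurable]: "k n \<in> ?G \<rightarrow>\<^sub>M count_space UNIV" for n
    unfolding k_def by measurable
  have [measurable]: "Measurable.pred ?G (\<lambda>\<omega>. \<sigma> \<omega> < t)"
    by (rule ext.stopping_time_less_const[OF \<sigma>])
  have X[measurable]: "X (enn2real s) \<in> borel_measurable ?G" if "s \<le> t" for s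
    using X_adapted_ext[of s] ext.sets_F_mono[OF that] ext.space_F
    by (auto simp: measurable_def)
  have "(\<lambda>\<omega>. X (enn2real (min t (ennreal (a n (k n \<omega>))))) \<omega>) \<in> borel_measurable ?G" for n
    by (rule measurable_compose_countable[OF X k]) simp
  then show "u n \<in> borel_measurable ?G" for n
    unfolding u_def by (intro measurable_If X) auto
  fix \<omega> assume "\<omega> \<in> space ?G"
  then have \<omega>: "\<omega> \<in> space M" by (simp add: ext.space_F)
  show "(\<lambda>n. u n \<omega>) \<longlonglongrightarrow> X (enn2real (min (\<sigma> \<omega>) t)) \<omega>"
  proof (cases "\<sigma> \<omega> < t")
    case True
    define s where "s = enn2real (\<sigma> \<omega>)"
    have s: "\<sigma> \<omega> = ennreal s" "0 \<le> s"
      using True by (auto simp: s_def ennreal_enn2real_if)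
    let ?a = "\<lambda>n. a n (k n \<omega>)"
    have k_eq: "real (k n \<omega>) = of_int \<lfloor>real (Suc n) * s\<rfloor>" for n
      using True s(2) by (simp add: k_def s_def min_absorb1)
    have "real (Suc n) * s < real (k n \<omega>) + 1" "real (k n \<omega>) \<le> real (Suc n) * s" for n
      unfolding k_eq by linarith+
    then have a_gt: "s < ?a n" and a_le: "?a n \<le> s + 1 / Suc n" for n
      by (simp_all add: a_def less_divide_eq divide_le_eq distrib_right mult.commute[of s] del: of_nat_Suc)
    have "(\<lambda>n. s + 1 / real (Suc n)) \<longlonglongrightarrow> s + 0"
      by (intro tendsto_intros LIMSEQ_Suc lim_const_over_n)
    then have a_lim: "?a \<longlonglongrightarrow> s"
      using a_gt a_le by (intro tendsto_sandwich[of "\<lambda>_. s" ?a]) (auto intro!: always_eventually less_imp_le)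
    then have "filterlim ?a (at_right s) sequentially"
      using a_gt by (auto simp: filterlim_at intro!: always_eventually)
    moreover have "((\<lambda>r. X r \<omega>) \<longlongrightarrow> X s \<omega>) (at_right s)"
      using right_cont \<omega> s(2) by (simp add: right_continuous_paths_def continuous_within)
    ultimately have "(\<lambda>n. X (?a n) \<omega>) \<longlonglongrightarrow> X s \<omega>"
      by (rule filterlim_compose[rotated])
    moreover have "\<forall>\<^sub>F n in sequentially. ennreal (?a n) < t"
      using order_tendstoD(2)[OF tendsto_ennrealI[OF a_lim]] True s(1) by auto
    then have "\<forall>\<^sub>F n in sequentially. X (?a n) \<omega> = u n \<omega>"
    proof eventually_elim
      case (elim n)
      then show ?case
        using True a_gt[of n] s(2) by (simp add: u_def min_absorb2)
    qed
    ultimately have "(\<lambda>n. u n \<omega>) \<longlonglongrightarrow> X s \<omega>"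
      by (rule Lim_transform_eventually)
    then show ?thesis using True by (simp add: s_def min_absorb1)
  qed (simp add: u_def min_absorb2)
qed

text \<open>On \<open>{\<sigma> \<le> t}\<close> the price at \<open>\<sigma>\<close> is the price
  at \<open>min \<sigma> t\<close>, which is known at time \<open>t\<close>.\<close>

lemma X_at_measurable:
  assumes \<sigma>: "stop_time M F \<sigma>"
  shows "X_at \<sigma> \<in> borel_measurable (sigma_at M F \<sigma>)"
proof (rule measurableI)
  fix B :: "(real ^ 'd) set" assume B: "B \<in> sets borel"
  have "{\<omega>\<in>{\<omega>\<in>space M. X_at \<sigma> \<omega> \<in> B}. \<sigma> \<omega> \<le> t} \<in> sets (ext_filtration M F t)" for t
  proof -
    have "{\<omega>\<in>space M. X (enn2real (min (\<sigma> \<omega>) t)) \<omega> \<in> B} \<inter> {\<omega>\<in>space M. \<sigma> \<omega> \<le> t}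
        \<in> sets (ext_filtration M F t)"
      using measurable_sets[OF X_stopped_measurable[OF \<sigma>] B, of t] stopping_timeD[OF \<sigma>, of t]
      by (intro sets.Int) (simp_all add: pred_def ext.space_F vimage_def Int_def conj_commute)
    also have "{\<omega>\<in>space M. X (enn2real (min (\<sigma> \<omega>) t)) \<omega> \<in> B} \<inter> {\<omega>\<in>space M. \<sigma> \<omega> \<le> t}
        = {\<omega>\<in>{\<omega>\<in>space M. X_at \<sigma> \<omega> \<in> B}. \<sigma> \<omega> \<le> t}"
      by (auto simp: min_absorb1)
    finally show ?thesis .
  qed
  then have "{\<omega>\<in>space M. X_at \<sigma> \<omega> \<in> B} \<in> sets (sigma_at M F \<sigma>)"
    by (intro ext.sets_pre_sigmaI \<sigma>)
  then show "X_at \<sigma> -` B \<inter> space (sigma_at M F \<sigma>) \<in> sets (sigma_at M F \<sigma>)"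
    by (simp add: ext.space_pre_sigma vimage_def Int_def conj_commute)
qed simp

lemma X_at_measurable_mono:
  assumes "stop_time M F \<sigma>" "stop_time M F \<tau>" "\<And>\<omega>. \<omega> \<in> space M \<Longrightarrow> \<sigma> \<omega> \<le> \<tau> \<omega>"
  shows "X_at \<sigma> \<in> borel_measurable (sigma_at M F \<tau>)"
  by (rule measurable_sigma_at_mono[OF assms X_at_measurable[OF assms(1)]])

section \<open>First passage times of the gain from holding a fixed direction\<close>

text \<open>First time from \<open>\<sigma>\<close> on at which the gain of holding \<open>H\<close>
  since \<open>\<sigma>\<close> enters the open half-line above \<open>c\<close>; the infimum of the
  empty set is \<infinity>, meaning that this never happens.\<close>

definition debut :: "('a \<Rightarrow> real ^ 'd) \<Rightarrow> ('a \<Rightarrow> ennreal) \<Rightarrow> real \<Rightarrow> 'a \<Rightarrow> ennreal" where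
  "debut H \<sigma> c \<omega> =
     Inf (ennreal ` {t. 0 \<le> t \<and> \<sigma> \<omega> \<le> ennreal t \<and> c < H \<omega> \<bullet> (X t \<omega> - X_at \<sigma> \<omega>)})"

lemma le_debut: "\<sigma> \<omega> \<le> debut H \<sigma> c \<omega>"
  unfolding debut_def by (rule Inf_greatest) auto

lemma debut_le:
  "0 \<le> t \<Longrightarrow> \<sigma> \<omega> \<le> ennreal t \<Longrightarrow> c < H \<omega> \<bullet> (X t \<omega> - X_at \<sigma> \<omega>) \<Longrightarrow> debut H \<sigma> c \<omega> \<le> ennreal t"
  unfolding debut_def by (rule Inf_lower) auto

lemma debut_lessE:
  assumes "debut H \<sigma> c \<omega> < b"
  obtains t where "0 \<le> t" "ennreal t < b" "\<sigma> \<omega> \<le> ennreal t" "c < H \<omega> \<bullet> (X t \<omega> - X_at \<sigma> \<omega>)"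
  using assms unfolding debut_def Inf_less_iff by auto

lemma increment_right_tendsto:
  assumes "\<omega> \<in> space M" "0 \<le> s"
  shows "((\<lambda>r. H \<omega> \<bullet> (X r \<omega> - x)) \<longlongrightarrow> H \<omega> \<bullet> (X s \<omega> - x)) (at_right s)"
  using right_cont assms
  by (intro tendsto_intros) (simp add: right_continuous_paths_def continuous_within)

text \<open>A gain below \<open>c\<close> at the infimum would by right-continuity stay below
  \<open>c\<close> on a right neighbourhood, leaving no time there with gain above \<open>c\<close>.
  Only the weak inequality survives, because the infimum itself need not belong to the set.\<close>

lemma debut_attained:
  assumes \<omega>: "\<omega> \<in> space M" and fin: "debut H \<sigma> c \<omega> < \<infinity>"
  shows "c \<le> H \<omega> \<bullet> (X_at (debut H \<sigma> c) \<omega> - X_at \<sigma> \<omega>)"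
proof (rule ccontr)
  define d where "d = enn2real (debut H \<sigma> c \<omega>)"
  have d: "debut H \<sigma> c \<omega> = ennreal d" "0 \<le> d"
    using fin by (auto simp: d_def ennreal_enn2real_if)
  assume "\<not> c \<le> H \<omega> \<bullet> (X_at (debut H \<sigma> c) \<omega> - X_at \<sigma> \<omega>)"
  then have less: "H \<omega> \<bullet> (X d \<omega> - X_at \<sigma> \<omega>) < c"
    by (simp add: d_def)
  then obtain b where b: "d < b" "\<And>r. d < r \<Longrightarrow> r < b \<Longrightarrow> H \<omega> \<bullet> (X r \<omega> - X_at \<sigma> \<omega>) < c"
    using order_tendstoD(2)[OF increment_right_tendsto[OF \<omega> d(2), of H "X_at \<sigma> \<omega>"] less]
    unfolding eventually_at_right_field by blast
  have "debut H \<sigma> c \<omega> < ennreal b"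
    using b(1) d by (simp add: ennreal_less_iff)
  then obtain t where t: "0 \<le> t" "ennreal t < ennreal b" "\<sigma> \<omega> \<le> ennreal t"
      "c < H \<omega> \<bullet> (X t \<omega> - X_at \<sigma> \<omega>)"
    by (rule debut_lessE)
  have "d \<le> t"
    using debut_le[of t \<sigma> \<omega> c H, OF t(1,3,4)] d t(1) by simp
  moreover have "t < b"
    using t(1,2) by (simp add: ennreal_less_iff)
  ultimately show False
    using b(2)[of t] less t(4) by (cases "t = d") auto
qed

text \<open>Exceeding \<open>c\<close> is an open condition, so by right-continuity a time at which
  it holds can be moved slightly to the right to a rational. Hence
  \<open>{debut H \<sigma> c < r}\<close> is a union of countably many events \<open>A q\<close>
  with \<open>q < r\<close>, each known at time \<open>q\<close>.\<close>

lemma stop_time_debut: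
  assumes \<sigma>: "stop_time M F \<sigma>" and H: "H \<in> borel_measurable (sigma_at M F \<sigma>)"
  shows "stop_time M F (debut H \<sigma> c)"
proof (rule stop_timeI_less)
  fix r :: real assume "0 < r"
  define A where "A q = {\<omega>\<in>space M. \<sigma> \<omega> \<le> ennreal q \<and> c < H \<omega> \<bullet> (X q \<omega> - X_at \<sigma> \<omega>)}" for q
  have A: "A q \<in> sets (F q)" if "0 \<le> q" for q
  proof -
    \<comment> \<open>Replacing the fixed date \<open>q\<close> by the stopping time
      \<open>max \<sigma> q\<close> puts \<open>H\<close> and both prices into one sigma-algebra; on
      \<open>{?m \<le> q}\<close>, which is \<open>{\<sigma> \<le> q}\<close>, this time equals
      \<open>q\<close>.\<close>
    let ?m = "\<lambda>\<omega>. max (\<sigma> \<omega>) (ennreal q)"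
    have m: "stop_time M F ?m"
      by (intro stopping_time_max stopping_time_const \<sigma>)
    have [measurable]: "H \<in> borel_measurable (sigma_at M F ?m)" "X_at \<sigma> \<in> borel_measurable (sigma_at M F ?m)"
        "X_at ?m \<in> borel_measurable (sigma_at M F ?m)"
      by (rule measurable_sigma_at_mono[OF \<sigma> m _ H], simp)
         (rule X_at_measurable_mono[OF \<sigma> m], simp, rule X_at_measurable[OF m])
    have "{\<omega>\<in>space (sigma_at M F ?m). c < H \<omega> \<bullet> (X_at ?m \<omega> - X_at \<sigma> \<omega>)} \<in> sets (sigma_at M F ?m)"
      by measurable
    from ext.sets_pre_sigmaD[OF m this, of "ennreal q"]
    have "{\<omega>\<in>{\<omega>\<in>space M. c < H \<omega> \<bullet> (X_at ?m \<omega> - X_at \<sigma> \<omega>)}. ?m \<omega> \<le> ennreal q} \<in> sets (F q)"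
      using that by (simp add: ext_filtration_def ext.space_pre_sigma)
    also have "{\<omega>\<in>{\<omega>\<in>space M. c < H \<omega> \<bullet> (X_at ?m \<omega> - X_at \<sigma> \<omega>)}. ?m \<omega> \<le> ennreal q} = A q"
      using that by (auto simp: A_def max_absorb2)
    finally show ?thesis .
  qed
  have "{\<omega>\<in>space M. debut H \<sigma> c \<omega> < ennreal r} = (\<Union>q\<in>{q\<in>\<rat>. 0 \<le> q \<and> q < r}. A q)"
  proof safe
    fix \<omega> assume \<omega>: "\<omega> \<in> space M" and "debut H \<sigma> c \<omega> < ennreal r"
    then obtain t where t: "0 \<le> t" "ennreal t < ennreal r" "\<sigma> \<omega> \<le> ennreal t"
      "c < H \<omega> \<bullet> (X t \<omega> - X_at \<sigma> \<omega>)"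
      by (auto elim: debut_lessE)
    then obtain b where b: "t < b" "\<And>s. t < s \<Longrightarrow> s < b \<Longrightarrow> c < H \<omega> \<bullet> (X s \<omega> - X_at \<sigma> \<omega>)"
      using order_tendstoD(1)[OF increment_right_tendsto[OF \<omega> t(1), of H "X_at \<sigma> \<omega>"] t(4)]
      unfolding eventually_at_right_field by blast
    have "t < min b r"
      using b(1) t(1,2) by (simp add: ennreal_less_iff)
    then obtain q where q: "q \<in> \<rat>" "t < q" "q < min b r"
      using Rats_dense_in_real by blast
    then have "\<sigma> \<omega> \<le> ennreal q"
      using t(3) by (meson ennreal_leI less_imp_le order_trans)
    then show "\<omega> \<in> (\<Union>q\<in>{q\<in>\<rat>. 0 \<le> q \<and> q < r}. A q)"
      using q t(1) b(2)[of q] \<omega> by (auto simp: A_def intro!: bexI[of _ q])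
  next
    fix \<omega> q assume q: "0 \<le> q" "q < r" and "\<omega> \<in> A q"
    then have "debut H \<sigma> c \<omega> \<le> ennreal q"
      by (intro debut_le) (auto simp: A_def)
    also have "\<dots> < ennreal r"
      using q by (simp add: ennreal_less_iff)
    finally show "debut H \<sigma> c \<omega> < ennreal r" .
  qed (auto simp: A_def)
  also have "\<dots> \<in> sets (F r)"
  proof -
    have "A q \<in> sets (F r)" if "0 \<le> q" "q < r" for q
      using A[of q] F_mono[of q r] that by auto
    moreover have "countable {q \<in> \<rat>. 0 \<le> q \<and> q < r}"
      by (rule countable_subset[OF _ countable_rat]) auto
    ultimately show ?thesis
      by (intro sets.countable_UN') auto
  qed
  finally show "{\<omega>\<in>space M. debut H \<sigma> c \<omega> < ennreal r} \<in> sets (F r)" .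
qed

section \<open>Gains of simple strategies and of one-period strategies\<close>

text \<open>Realised gain of the first \<open>k\<close> periods. For a simple strategy and
  \<open>k = steps S\<close> it is almost surely the terminal wealth from initial capital 0, with no
  limit to handle.\<close>

definition gain :: "('a, 'd) strategy \<Rightarrow> nat \<Rightarrow> 'a \<Rightarrow> real" where
  "gain S k \<omega> = (\<Sum>j<k. holdings S j \<omega> \<bullet> (X_at (times S (Suc j)) \<omega> - X_at (times S j) \<omega>))"

lemma gain_Suc:
  "gain S (Suc k) \<omega> = gain S k \<omega> + holdings S k \<omega> \<bullet> (X_at (times S (Suc k)) \<omega> - X_at (times S k) \<omega>)"
  by (simp add: gain_def)

lemma simple_strategy_times_mono:
  assumes S: "simple_strategy M F S" and \<omega>: "\<omega> \<in> space M" and "j \<le> k" "k \<le> steps S"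
  shows "times S j \<omega> \<le> times S k \<omega>"
  using \<open>j \<le> k\<close> \<open>k \<le> steps S\<close>
proof (induction k rule: dec_induct)
  case (step n)
  then have "times S j \<omega> \<le> times S n \<omega>" by simp
  also have "\<dots> \<le> times S (Suc n) \<omega>"
    using S \<omega> step.prems by (simp add: simple_strategy_def)
  finally show ?case .
qed simp

lemma gain_measurable:
  assumes S: "simple_strategy M F S" and k: "k \<le> steps S"
  shows "gain S k \<in> borel_measurable (sigma_at M F (times S k))"
proof -
  have stop: "stop_time M F (times S j)" if "j \<le> steps S" for j
    using S that by (simp add: simple_strategy_def)
  have "X_at (times S j) \<in> borel_measurable (sigma_at M F (times S k))" if "j \<le> k" for j
    using that k by (intro X_at_measurable_mono stop simple_strategy_times_mono[OF S]) auto
  moreover have "holdings S j \<in> borel_measurable (sigma_at M F (times S k))" if "j < k" for j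
    using that k S
    by (intro measurable_sigma_at_mono[OF stop stop simple_strategy_times_mono[OF S], of j k])
       (auto simp: simple_strategy_def)
  ultimately show ?thesis
    unfolding gain_def by (intro borel_measurable_sum borel_measurable_inner borel_measurable_diff) auto
qed

text \<open>Once the gain is almost surely nonnegative, a strictly positive gain with positive
  probability is the same as a gain that is not almost surely zero.\<close>

lemma arbitrage_iff:
  assumes S: "simple_strategy M F S"
  shows "arbitrage M X S \<longleftrightarrow>
    (AE \<omega> in M. 0 \<le> gain S (steps S) \<omega>) \<and> \<not> (AE \<omega> in M. gain S (steps S) \<omega> = 0)"
proof -
  have "stop_time M F (times S (steps S))"
    using S by (simp add: simple_strategy_def)
  then have [measurable]: "gain S (steps S) \<in> borel_measurable M"
    using gain_measurable[OF S order_refl] by (rule measurable_sigma_atD)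
  have eq: "AE \<omega> in M. terminal_wealth X S 0 \<omega> = gain S (steps S) \<omega>"
    using AE_terminal_wealth_eq[OF S, of X 0] by (simp add: gain_def)
  let ?P = "{\<omega>\<in>space M. 0 < terminal_wealth X S 0 \<omega>}"
  \<comment> \<open>Terminal wealth is only almost surely equal to a measurable function;
    completeness of \<open>M\<close> makes this event measurable.\<close>
  have "?P \<in> sets M"
  proof (rule in_sets_AE)
    show "AE \<omega> in M. \<omega> \<in> {\<omega>\<in>space M. 0 < gain S (steps S) \<omega>} \<longleftrightarrow> \<omega> \<in> ?P"
      using eq by eventually_elim auto
  qed auto
  then have "0 < measure M ?P \<longleftrightarrow> \<not> (AE \<omega> in M. \<omega> \<notin> ?P)"
    using prob_eq_0 measure_nonneg[of M ?P] by (simp add: less_le)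
  also have "(AE \<omega> in M. \<omega> \<notin> ?P) \<longleftrightarrow> (AE \<omega> in M. gain S (steps S) \<omega> \<le> 0)"
  proof
    assume "AE \<omega> in M. \<omega> \<notin> ?P"
    with eq AE_space show "AE \<omega> in M. gain S (steps S) \<omega> \<le> 0"
      by eventually_elim auto
  next
    assume "AE \<omega> in M. gain S (steps S) \<omega> \<le> 0"
    with eq show "AE \<omega> in M. \<omega> \<notin> ?P"
      by eventually_elim auto
  qed
  finally have "0 < measure M ?P \<longleftrightarrow> \<not> (AE \<omega> in M. gain S (steps S) \<omega> \<le> 0)" .
  moreover have "(AE \<omega> in M. 0 \<le> terminal_wealth X S 0 \<omega>) \<longleftrightarrow> (AE \<omega> in M. 0 \<le> gain S (steps S) \<omega>)"
    by (rule eventually_cong[OF eq]) auto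
  moreover have "(AE \<omega> in M. gain S (steps S) \<omega> \<le> 0) \<longleftrightarrow> (AE \<omega> in M. gain S (steps S) \<omega> = 0)"
    if "AE \<omega> in M. 0 \<le> gain S (steps S) \<omega>"
    by (rule eventually_cong[OF that]) auto
  ultimately show ?thesis
    unfolding arbitrage_def by blast
qed

text \<open>A simple strategy must have 0 as its first trading date, so the representation takes two
  steps: no holdings up to \<open>\<sigma>\<close>, then \<open>H\<close> on
  \<open>(\<sigma>, \<tau>]\<close>.\<close>

definition one_period :: "('a \<Rightarrow> ennreal) \<Rightarrow> ('a \<Rightarrow> ennreal) \<Rightarrow> ('a \<Rightarrow> real ^ 'd) \<Rightarrow> ('a, 'd) strategy" where
  "one_period \<sigma> \<tau> H = \<lparr>steps = 2,
     times = (\<lambda>j. if j = 0 then \<lambda>_. 0 else if j = 1 then \<sigma> else \<tau>),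
     holdings = (\<lambda>j. if j = 0 then \<lambda>_. 0 else H)\<rparr>"

lemma simple_strategy_one_period:
  assumes "stop_time M F \<sigma>" "stop_time M F \<tau>" "\<And>\<omega>. \<omega> \<in> space M \<Longrightarrow> \<sigma> \<omega> \<le> \<tau> \<omega>"
    and fin: "AE \<omega> in M. \<tau> \<omega> < \<infinity>" and "H \<in> borel_measurable (sigma_at M F \<sigma>)"
  shows "simple_strategy M F (one_period \<sigma> \<tau> H)"
proof -
  have "AE \<omega> in M. \<sigma> \<omega> < \<infinity>"
    using fin AE_space by eventually_elim (use assms(3) in \<open>auto intro: le_less_trans\<close>)
  then show ?thesis
    using assms by (auto simp: simple_strategy_def one_period_def stopping_time_const less_2_cases_iff)
qed

lemma gain_one_period: "gain (one_period \<sigma> \<tau> H) 2 \<omega> = H \<omega> \<bullet> (X_at \<tau> \<omega> - X_at \<sigma> \<omega>)"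
  by (simp add: gain_def one_period_def numeral_2_eq_2)

lemma wealth_one_period:
  "wealth X (one_period \<sigma> \<tau> H) v t \<omega> = v + H \<omega> \<bullet> (stopped_at X \<tau> t \<omega> - stopped_at X \<sigma> t \<omega>)"
  by (simp add: wealth_def one_period_def numeral_2_eq_2)

lemma has_form_one_period: "has_form M (one_period \<sigma> \<tau> H) H \<sigma> \<tau>"
  by (simp add: has_form_def position_def one_period_def numeral_2_eq_2)

lemma arbitrage_one_period:
  assumes "simple_strategy M F (one_period \<sigma> \<tau> H)"
  shows "arbitrage M X (one_period \<sigma> \<tau> H) \<longleftrightarrow>
    (AE \<omega> in M. 0 \<le> H \<omega> \<bullet> (X_at \<tau> \<omega> - X_at \<sigma> \<omega>)) \<and>
    \<not> (AE \<omega> in M. H \<omega> \<bullet> (X_at \<tau> \<omega> - X_at \<sigma> \<omega>) = 0)"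
  using arbitrage_iff[OF assms] gain_one_period[of \<sigma> \<tau> H] by (simp add: one_period_def)

section \<open>Absence of simple arbitrage implies (NOA)\<close>

text \<open>Sets outside \<open>sets M\<close> have \<open>measure\<close> 0 by convention, so the
  claim also covers events defined by an uncountable supremum.\<close>

lemma measure_eq_0_if_AE_notin:
  assumes "AE \<omega> in M. \<omega> \<notin> A"
  shows "measure M A = 0"
  using assms prob_eq_0[of A] by (cases "A \<in> sets M") (auto simp: measure_notin_sets)

lemma no_obvious_arbitrage_if_no_arbitrage:
  assumes no_arb: "\<nexists>S. simple_strategy M F S \<and> arbitrage M X S"
  shows "no_obvious_arbitrage M F X"
  unfolding no_obvious_arbitrage_def
proof (intro allI impI)
  fix \<sigma> and \<epsilon> :: real and H :: "'a \<Rightarrow> real ^ 'd"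
  assume \<sigma>: "stop_time M F \<sigma>" and fin: "0 < measure M {\<omega>\<in>space M. \<sigma> \<omega> < \<infinity>}" and "0 < \<epsilon>"
    and "direction M F \<sigma> H"
  then have H: "H \<in> borel_measurable (sigma_at M F \<sigma>)"
    by (simp add: direction_def)
  define Z where "Z t \<omega> = H \<omega> \<bullet> (X t \<omega> - X_at \<sigma> \<omega>)" for t \<omega>
  let ?sup = "\<lambda>\<omega>. SUP t\<in>{enn2real (\<sigma> \<omega>)..}. ereal (Z t \<omega>)"
  define A where "A = {\<omega>\<in>space M. \<sigma> \<omega> < \<infinity> \<and> ?sup \<omega> < ereal \<epsilon>}"
  \<comment> \<open>This replaces a supremum over uncountably many times by a stopping time: the
    gain stays at or below \<open>c\<close> exactly if its first passage above \<open>c\<close>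
    never occurs.\<close>
  have debut_infinite_iff: "debut H \<sigma> c \<omega> = \<infinity> \<longleftrightarrow> ?sup \<omega> \<le> ereal c" if "\<sigma> \<omega> < \<infinity>" for c \<omega>
  proof
    assume inf: "debut H \<sigma> c \<omega> = \<infinity>"
    have "Z t \<omega> \<le> c" if "enn2real (\<sigma> \<omega>) \<le> t" for t
    proof (rule ccontr)
      assume "\<not> Z t \<omega> \<le> c"
      moreover have "0 \<le> t"
        using that enn2real_nonneg order_trans by blast
      moreover have "\<sigma> \<omega> \<le> ennreal t"
        using that \<open>\<sigma> \<omega> < \<infinity>\<close> by (metis ennreal_enn2real ennreal_leI infinity_ennreal_def)
      ultimately show False
        using debut_le[of t \<sigma> \<omega> c H] inf by (simp add: Z_def top_unique)
    qed
    then show "?sup \<omega> \<le> ereal c"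
      by (auto intro!: SUP_least)
  next
    assume sup: "?sup \<omega> \<le> ereal c"
    show "debut H \<sigma> c \<omega> = \<infinity>"
    proof (rule ccontr)
      assume "debut H \<sigma> c \<omega> \<noteq> \<infinity>"
      then have "debut H \<sigma> c \<omega> < \<infinity>"
        by (simp add: top.not_eq_extremum)
      then obtain t where t: "0 \<le> t" "\<sigma> \<omega> \<le> ennreal t" "c < Z t \<omega>"
        unfolding Z_def by (auto elim: debut_lessE)
      then have "enn2real (\<sigma> \<omega>) \<le> t"
        by (metis enn2real_ennreal enn2real_mono ennreal_less_top)
      then have "ereal (Z t \<omega>) \<le> ?sup \<omega>"
        by (intro SUP_upper) simp
      with sup t(3) show False
        by (meson ereal_less_eq(3) linorder_not_le order_trans)
    qed
  qed
  have [measurable]: "debut H \<sigma> c \<in> borel_measurable M" for c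
    by (rule stop_time_measurable[OF stop_time_debut[OF \<sigma> H]])
  have [measurable]: "\<sigma> \<in> borel_measurable M"
    by (rule stop_time_measurable[OF \<sigma>])
  \<comment> \<open>The supremum is below \<open>\<epsilon>\<close> iff it is at most some rational
    \<open>c < \<epsilon>\<close>, which makes \<open>A\<close> a countable union of measurable
    events. Measurability is what lets \<open>measure M A = 0\<close> yield
    \<open>\<omega> \<notin> A\<close> almost surely.\<close>
  have "A = (\<Union>c\<in>{c\<in>\<rat>. c < \<epsilon>}. {\<omega>\<in>space M. \<sigma> \<omega> < \<infinity> \<and> debut H \<sigma> c \<omega> = \<infinity>})"
  proof safe
    fix \<omega> assume \<omega>: "\<omega> \<in> A"
    then have "?sup \<omega> < ereal \<epsilon>"
      by (simp add: A_def)
    then obtain b :: real where b: "?sup \<omega> < ereal b" "ereal b < ereal \<epsilon>"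
      using ereal_dense2 by blast
    then obtain c where c: "c \<in> \<rat>" "b < c" "c < \<epsilon>"
      using Rats_dense_in_real[of b \<epsilon>] by auto
    then have "?sup \<omega> \<le> ereal c"
      using b by (meson ereal_less_eq(3) less_imp_le order_trans)
    then show "\<omega> \<in> (\<Union>c\<in>{c\<in>\<rat>. c < \<epsilon>}. {\<omega>\<in>space M. \<sigma> \<omega> < \<infinity> \<and> debut H \<sigma> c \<omega> = \<infinity>})"
      using \<omega> c debut_infinite_iff[of \<omega> c] by (auto simp: A_def)
  next
    fix \<omega> c assume *: "\<omega> \<in> space M" "c < \<epsilon>" "\<sigma> \<omega> < \<infinity>" "debut H \<sigma> c \<omega> = \<infinity>"
    then have "?sup \<omega> \<le> ereal c" using debut_infinite_iff by blast
    also have "\<dots> < ereal \<epsilon>" using * by simp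
    finally show "\<omega> \<in> A" using * by (simp add: A_def)
  qed
  also have "\<dots> \<in> sets M"
    using countable_subset[OF _ countable_rat, of "{c\<in>\<rat>. c < \<epsilon>}"] by (intro sets.countable_UN') auto
  finally have A: "A \<in> sets M" .
  have "measure M A \<noteq> 0"
  proof
    assume "measure M A = 0"
    then have notA: "AE \<omega> in M. \<omega> \<notin> A"
      using prob_eq_0[OF A] by simp
    \<comment> \<open>If (NOA) fails, the supremum is almost surely at least
      \<open>\<epsilon>\<close> where \<open>\<sigma>\<close> is finite, but
      \<open>\<epsilon>\<close> need not be exceeded. The lower level \<open>\<epsilon> / 2\<close>
      is exceeded at a finite time and is still a strictly positive gain.\<close>
    define \<rho> where "\<rho> = debut H \<sigma> (\<epsilon> / 2)"
    have \<rho>: "stop_time M F \<rho>" "\<And>\<omega>. \<sigma> \<omega> \<le> \<rho> \<omega>"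
      unfolding \<rho>_def by (rule stop_time_debut[OF \<sigma> H], rule le_debut)
    have \<rho>_fin: "AE \<omega> in M. \<sigma> \<omega> < \<infinity> \<longrightarrow> \<rho> \<omega> < \<infinity>"
      using notA AE_space
    proof eventually_elim
      case (elim \<omega>)
      show ?case
      proof
        assume fin: "\<sigma> \<omega> < \<infinity>"
        have "ereal (\<epsilon> / 2) < ereal \<epsilon>" using \<open>0 < \<epsilon>\<close> by simp
        moreover have "\<not> ?sup \<omega> < ereal \<epsilon>"
          using elim fin by (simp add: A_def)
        ultimately have "\<not> ?sup \<omega> \<le> ereal (\<epsilon> / 2)"
          by (meson le_less_trans)
        then show "\<rho> \<omega> < \<infinity>"
          using debut_infinite_iff[OF fin, of "\<epsilon> / 2"] by (auto simp: \<rho>_def less_top[symmetric])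
      qed
    qed
    \<comment> \<open>\<open>\<sigma>\<close> may be infinite with positive probability, whereas
      trading dates must be almost surely finite. Since \<open>{\<sigma> < \<infinity>}\<close> is
      the union of the events \<open>{\<sigma> \<le> n}\<close>, one of these has positive
      probability.\<close>
    have "\<not> (AE \<omega> in M. \<forall>n::nat. \<not> \<sigma> \<omega> \<le> ennreal n)"
    proof
      assume "AE \<omega> in M. \<forall>n::nat. \<not> \<sigma> \<omega> \<le> ennreal n"
      then have "AE \<omega> in M. \<omega> \<notin> {\<omega>\<in>space M. \<sigma> \<omega> < \<infinity>}"
      proof eventually_elim
        case (elim \<omega>)
        then show ?case
          using ennreal_Ex_less_of_nat[of "\<sigma> \<omega>"]
          by (auto simp: ennreal_of_nat_eq_real_of_nat intro: less_imp_le)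
      qed
      with fin show False
        using measure_eq_0_if_AE_notin by fastforce
    qed
    then obtain n :: nat where n: "\<not> (AE \<omega> in M. \<not> \<sigma> \<omega> \<le> ennreal n)"
      by (auto simp: AE_all_countable)
    \<comment> \<open>Inside \<open>{\<sigma> \<le> n}\<close>, \<open>H\<close> is held from
      \<open>\<sigma>\<close> to \<open>\<rho>\<close>; outside, both dates equal \<open>n\<close>
      and the holdings are 0.\<close>
    define \<sigma>' where "\<sigma>' \<omega> = min (\<sigma> \<omega>) (ennreal n)" for \<omega>
    define \<tau> where "\<tau> \<omega> = (if \<omega> \<in> {\<omega>\<in>space M. \<sigma> \<omega> \<le> ennreal n} then \<rho> \<omega> else ennreal n)" for \<omega>
    define H' where "H' \<omega> = (if \<sigma> \<omega> \<le> ennreal n then H \<omega> else 0)" for \<omega>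
    have \<sigma>': "stop_time M F \<sigma>'"
      unfolding \<sigma>'_def by (intro stopping_time_min stopping_time_const \<sigma>)
    have "(\<lambda>\<omega>. if \<sigma> \<omega> \<le> ennreal n then 1 else 0 :: real) \<in> borel_measurable (sigma_at M F \<sigma>')"
      unfolding \<sigma>'_def by (rule measurable_sigma_at_min_const[OF \<sigma>]) simp
    then have "{\<omega>\<in>space (sigma_at M F \<sigma>'). (if \<sigma> \<omega> \<le> ennreal n then 1 else 0 :: real) = 1}
        \<in> sets (sigma_at M F \<sigma>')"
      by (rule borel_measurable_eq) simp
    moreover have "{\<omega>\<in>space (sigma_at M F \<sigma>'). (if \<sigma> \<omega> \<le> ennreal n then 1 else 0 :: real) = 1} =
        {\<omega>\<in>space M. \<sigma> \<omega> \<le> ennreal n}"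
      unfolding ext.space_pre_sigma by auto
    ultimately have "{\<omega>\<in>space M. \<sigma> \<omega> \<le> ennreal n} \<in> sets (sigma_at M F \<sigma>')"
      by simp
    then have \<tau>: "stop_time M F \<tau>"
      unfolding \<tau>_def
      by (rule stop_time_if[OF \<sigma>' _ \<rho>(1) stopping_time_const]) (use \<rho>(2) in \<open>auto simp: \<sigma>'_def min_le_iff_disj\<close>)
    have S: "simple_strategy M F (one_period \<sigma>' \<tau> H')"
    proof (rule simple_strategy_one_period[OF \<sigma>' \<tau>])
      show "\<sigma>' \<omega> \<le> \<tau> \<omega>" for \<omega>
        using \<rho>(2)[of \<omega>] by (auto simp: \<sigma>'_def \<tau>_def min_le_iff_disj)
      show "AE \<omega> in M. \<tau> \<omega> < \<infinity>"
        using \<rho>_fin by eventually_elim (auto simp: \<tau>_def intro: le_less_trans)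
      show "H' \<in> borel_measurable (sigma_at M F \<sigma>')"
        unfolding \<sigma>'_def H'_def by (rule measurable_sigma_at_min_const[OF \<sigma> H])
    qed
    have val: "AE \<omega> in M. (\<sigma> \<omega> \<le> ennreal n \<longrightarrow> \<epsilon> / 2 \<le> H' \<omega> \<bullet> (X_at \<tau> \<omega> - X_at \<sigma>' \<omega>)) \<and>
        (\<not> \<sigma> \<omega> \<le> ennreal n \<longrightarrow> H' \<omega> \<bullet> (X_at \<tau> \<omega> - X_at \<sigma>' \<omega>) = 0)"
      using \<rho>_fin AE_space
    proof eventually_elim
      case (elim \<omega>)
      show ?case
      proof (cases "\<sigma> \<omega> \<le> ennreal n")
        case True
        then have "\<rho> \<omega> < \<infinity>"
          using elim le_less_trans[OF True, of \<infinity>] by simp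
        then show ?thesis
          using debut_attained[of \<omega> H \<sigma> "\<epsilon> / 2"] True elim
          by (simp add: \<rho>_def[symmetric] \<tau>_def \<sigma>'_def H'_def min_absorb1)
      qed (simp add: H'_def)
    qed
    have "AE \<omega> in M. 0 \<le> H' \<omega> \<bullet> (X_at \<tau> \<omega> - X_at \<sigma>' \<omega>)"
      using val
    proof eventually_elim
      case (elim \<omega>)
      then show ?case using \<open>0 < \<epsilon>\<close> by (cases "\<sigma> \<omega> \<le> ennreal n") auto
    qed
    moreover have "\<not> (AE \<omega> in M. H' \<omega> \<bullet> (X_at \<tau> \<omega> - X_at \<sigma>' \<omega>) = 0)"
    proof
      assume "AE \<omega> in M. H' \<omega> \<bullet> (X_at \<tau> \<omega> - X_at \<sigma>' \<omega>) = 0"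
      with val have "AE \<omega> in M. \<not> \<sigma> \<omega> \<le> ennreal n"
        by eventually_elim (use \<open>0 < \<epsilon>\<close> in auto)
      with n show False ..
    qed
    ultimately show False
      using no_arb S arbitrage_one_period[OF S] by blast
  qed
  then show "0 < measure M {\<omega>\<in>space M. \<sigma> \<omega> < \<infinity> \<and>
      (SUP t\<in>{enn2real (\<sigma> \<omega>)..}. ereal (H \<omega> \<bullet> (X t \<omega> - X_at \<sigma> \<omega>))) < ereal \<epsilon>}"
    using measure_nonneg[of M A] by (simp add: A_def Z_def less_le)
qed

section \<open>From a simple arbitrage to a bounded 0-admissible one\<close>

lemma arbitrage_one_periodE:
  assumes S: "simple_strategy M F S" and arb: "arbitrage M X S"
  obtains \<sigma> \<tau> H where "stop_time M F \<sigma>" "stop_time M F \<tau>" "\<And>\<omega>. \<omega> \<in> space M \<Longrightarrow> \<sigma> \<omega> \<le> \<tau> \<omega>"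
    "AE \<omega> in M. \<tau> \<omega> < \<infinity>" "H \<in> borel_measurable (sigma_at M F \<sigma>)" "\<And>\<omega>. norm (H \<omega>) = 1"
    "AE \<omega> in M. 0 \<le> H \<omega> \<bullet> (X_at \<tau> \<omega> - X_at \<sigma> \<omega>)"
    "\<not> (AE \<omega> in M. H \<omega> \<bullet> (X_at \<tau> \<omega> - X_at \<sigma> \<omega>) = 0)"
proof -
  let ?P = "\<lambda>k. (AE \<omega> in M. 0 \<le> gain S k \<omega>) \<and> \<not> (AE \<omega> in M. gain S k \<omega> = 0)"
  have P: "?P (steps S)"
    using arb unfolding arbitrage_iff[OF S] .
  have "\<not> ?P 0"
    by (simp add: gain_def)
  with P obtain j where j: "j < steps S" "\<not> ?P j" "?P (Suc j)"
    using ex_least_nat_less[of ?P "steps S"] by auto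
  define \<sigma> where "\<sigma> = times S j"
  define \<tau> where "\<tau> = times S (Suc j)"
  \<comment> \<open>Where the gain before the period is not positive, a nonnegative gain after it
    forces a nonnegative increment.\<close>
  define K where "K \<omega> = (if gain S j \<omega> \<le> 0 then holdings S j \<omega> else 0)" for \<omega>
  have \<sigma>: "stop_time M F \<sigma>" and \<tau>: "stop_time M F \<tau>" "AE \<omega> in M. \<tau> \<omega> < \<infinity>"
    and le: "\<And>\<omega>. \<omega> \<in> space M \<Longrightarrow> \<sigma> \<omega> \<le> \<tau> \<omega>"
    and hold[measurable]: "holdings S j \<in> borel_measurable (sigma_at M F \<sigma>)"
    using S j(1) by (auto simp: \<sigma>_def \<tau>_def simple_strategy_def)
  have [measurable]: "gain S j \<in> borel_measurable (sigma_at M F \<sigma>)"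
    unfolding \<sigma>_def using gain_measurable[OF S] j(1) by simp
  have K[measurable]: "K \<in> borel_measurable (sigma_at M F \<sigma>)"
    unfolding K_def by measurable
  have gain: "gain S (Suc j) \<omega> = gain S j \<omega> + holdings S j \<omega> \<bullet> (X_at \<tau> \<omega> - X_at \<sigma> \<omega>)" for \<omega>
    by (simp add: gain_Suc \<sigma>_def \<tau>_def)
  have K_nonneg: "AE \<omega> in M. 0 \<le> K \<omega> \<bullet> (X_at \<tau> \<omega> - X_at \<sigma> \<omega>)"
    using j(3)[THEN conjunct1] by eventually_elim (auto simp: K_def gain)
  \<comment> \<open>If this trade gained nothing, the period would not change a nonpositive gain, so
    the gain at \<open>j\<close> would be almost surely nonnegative; as \<open>?P j\<close> fails,
    it would be almost surely zero. Then \<open>K\<close> would agree with the original holdings and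
    the gain at \<open>Suc j\<close> would vanish too.\<close>
  have K_nonzero: "\<not> (AE \<omega> in M. K \<omega> \<bullet> (X_at \<tau> \<omega> - X_at \<sigma> \<omega>) = 0)"
  proof
    assume K0: "AE \<omega> in M. K \<omega> \<bullet> (X_at \<tau> \<omega> - X_at \<sigma> \<omega>) = 0"
    from K0 j(3)[THEN conjunct1] have "AE \<omega> in M. 0 \<le> gain S j \<omega>"
      by eventually_elim (auto simp: K_def gain split: if_splits)
    with j(2) have "AE \<omega> in M. gain S j \<omega> = 0"
      by blast
    with K0 have "AE \<omega> in M. gain S (Suc j) \<omega> = 0"
      by eventually_elim (simp add: K_def gain)
    with j(3) show False by blast
  qed
  obtain e :: "real ^ 'd" where e: "norm e = 1"
    using vector_choose_size[of 1] by auto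
  \<comment> \<open>The unit vector \<open>e\<close> is a placeholder where \<open>K\<close>
    vanishes. It earns nothing there, since \<open>\<tau>'\<close> closes the position at once at
    \<open>\<sigma>\<close>.\<close>
  define H where "H \<omega> = (if K \<omega> \<noteq> 0 then K \<omega> /\<^sub>R norm (K \<omega>) else e)" for \<omega>
  define A where "A = {\<omega>\<in>space M. K \<omega> \<noteq> 0}"
  define \<tau>' where "\<tau>' \<omega> = (if \<omega> \<in> A then \<tau> \<omega> else \<sigma> \<omega>)" for \<omega>
  have "{\<omega>\<in>space (sigma_at M F \<sigma>). K \<omega> \<noteq> 0} \<in> sets (sigma_at M F \<sigma>)"
    by measurable
  then have A: "A \<in> sets (sigma_at M F \<sigma>)"
    by (simp add: A_def ext.space_pre_sigma)
  have HK: "K \<omega> \<bullet> (X_at \<tau> \<omega> - X_at \<sigma> \<omega>) = norm (K \<omega>) * (H \<omega> \<bullet> (X_at \<tau>' \<omega> - X_at \<sigma> \<omega>))"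
    and H0: "K \<omega> = 0 \<Longrightarrow> H \<omega> \<bullet> (X_at \<tau>' \<omega> - X_at \<sigma> \<omega>) = 0" if "\<omega> \<in> space M" for \<omega>
    using that by (auto simp: H_def A_def \<tau>'_def)
  show thesis
  proof (rule that[OF \<sigma>])
    show "stop_time M F \<tau>'"
      unfolding \<tau>'_def by (rule stop_time_if[OF \<sigma> A \<tau>(1) \<sigma> le order_refl])
    show "\<sigma> \<omega> \<le> \<tau>' \<omega>" if "\<omega> \<in> space M" for \<omega>
      using le[OF that] by (simp add: \<tau>'_def)
    show "AE \<omega> in M. \<tau>' \<omega> < \<infinity>"
      using \<tau>(2) AE_space by eventually_elim (use le in \<open>auto simp: \<tau>'_def intro: le_less_trans\<close>)
    show "H \<in> borel_measurable (sigma_at M F \<sigma>)"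
      unfolding H_def by measurable
    show "norm (H \<omega>) = 1" for \<omega>
      by (simp add: H_def e)
    show "AE \<omega> in M. 0 \<le> H \<omega> \<bullet> (X_at \<tau>' \<omega> - X_at \<sigma> \<omega>)"
      using K_nonneg AE_space
    proof eventually_elim
      case (elim \<omega>)
      then show ?case
        using HK[of \<omega>] H0[of \<omega>] by (cases "K \<omega> = 0") (auto simp: zero_le_mult_iff)
    qed
    show "\<not> (AE \<omega> in M. H \<omega> \<bullet> (X_at \<tau>' \<omega> - X_at \<sigma> \<omega>) = 0)"
    proof
      assume "AE \<omega> in M. H \<omega> \<bullet> (X_at \<tau>' \<omega> - X_at \<sigma> \<omega>) = 0"
      then have "AE \<omega> in M. K \<omega> \<bullet> (X_at \<tau> \<omega> - X_at \<sigma> \<omega>) = 0"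
        using AE_space by eventually_elim (simp add: HK)
      with K_nonzero show False ..
    qed
  qed
qed

text \<open>If the position is below \<open>-\<delta>\<close> at some time before \<open>\<tau>\<close>, then from that time on it
  certainly recovers by at least \<open>\<delta>\<close>, which is an obvious arbitrage.\<close>

lemma AE_increment_nonneg:
  assumes noa: "no_obvious_arbitrage M F X"
    and \<sigma>: "stop_time M F \<sigma>" and \<tau>: "stop_time M F \<tau>" and fin: "AE \<omega> in M. \<tau> \<omega> < \<infinity>"
    and H: "H \<in> borel_measurable (sigma_at M F \<sigma>)" "\<And>\<omega>. norm (H \<omega>) = 1"
    and nonneg: "AE \<omega> in M. 0 \<le> H \<omega> \<bullet> (X_at \<tau> \<omega> - X_at \<sigma> \<omega>)"
  shows "AE \<omega> in M. \<forall>t\<ge>0. \<sigma> \<omega> \<le> ennreal t \<longrightarrow> ennreal t \<le> \<tau> \<omega> \<longrightarrow> 0 \<le> H \<omega> \<bullet> (X t \<omega> - X_at \<sigma> \<omega>)"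
proof -
  let ?H = "\<lambda>\<omega>. - H \<omega>"
  have not_less: "AE \<omega> in M. \<not> debut ?H \<sigma> \<delta> \<omega> < \<tau> \<omega>" if "0 < \<delta>" for \<delta>
  proof (rule ccontr)
    define \<rho> where "\<rho> = debut ?H \<sigma> \<delta>"
    assume contra: "\<not> (AE \<omega> in M. \<not> debut ?H \<sigma> \<delta> \<omega> < \<tau> \<omega>)"
    have \<rho>: "stop_time M F \<rho>"
      unfolding \<rho>_def using H(1) by (intro stop_time_debut \<sigma> borel_measurable_uminus)
    define A where "A = {\<omega>\<in>space M. \<rho> \<omega> < \<tau> \<omega>}"
    \<comment> \<open>The infinite value outside \<open>A\<close> restricts (NOA) at
      \<open>\<rho>'\<close> to the outcomes in \<open>A\<close>.\<close>
    define \<rho>' where "\<rho>' \<omega> = (if \<omega> \<in> A then \<rho> \<omega> else \<infinity>)" for \<omega>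
    have A: "A \<in> sets (sigma_at M F \<rho>)"
      using ext.stopping_time_less[OF \<rho> \<tau>] by (simp add: A_def pred_def ext.space_pre_sigma)
    have \<rho>': "stop_time M F \<rho>'"
      unfolding \<rho>'_def by (rule stop_time_if[OF \<rho> A \<rho> stopping_time_const]) auto
    have \<sigma>\<rho>': "\<sigma> \<omega> \<le> \<rho>' \<omega>" for \<omega>
      by (simp add: \<rho>'_def \<rho>_def le_debut)
    have fin_A: "\<rho>' \<omega> < \<infinity> \<longleftrightarrow> \<omega> \<in> A" for \<omega>
      by (auto simp: \<rho>'_def A_def intro: less_le_trans)
    have "\<not> (AE \<omega> in M. \<omega> \<notin> A)"
    proof
      assume "AE \<omega> in M. \<omega> \<notin> A"
      then have "AE \<omega> in M. \<not> \<rho> \<omega> < \<tau> \<omega>"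
        using AE_space by eventually_elim (auto simp: A_def)
      with contra show False by (simp add: \<rho>_def)
    qed
    moreover have "A \<in> sets M"
      using A sets_sigma_at_le[OF \<rho>] by blast
    ultimately have "0 < measure M A"
      using prob_eq_0[of A] measure_nonneg[of M A] by (simp add: less_le)
    moreover have "A = {\<omega>\<in>space M. \<rho>' \<omega> < \<infinity>}"
      unfolding fin_A by (auto simp: A_def)
    moreover have "direction M F \<rho>' H"
      using measurable_sigma_at_mono[OF \<sigma> \<rho>' \<sigma>\<rho>' H(1)] H(2) by (simp add: direction_def)
    ultimately have "0 < measure M {\<omega>\<in>space M. \<rho>' \<omega> < \<infinity> \<and>
        (SUP t\<in>{enn2real (\<rho>' \<omega>)..}. ereal (H \<omega> \<bullet> (X t \<omega> - X_at \<rho>' \<omega>))) < ereal \<delta>}"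
      using noa \<rho>' \<open>0 < \<delta>\<close> unfolding no_obvious_arbitrage_def by blast
    moreover have "AE \<omega> in M. \<omega> \<notin> {\<omega>\<in>space M. \<rho>' \<omega> < \<infinity> \<and>
        (SUP t\<in>{enn2real (\<rho>' \<omega>)..}. ereal (H \<omega> \<bullet> (X t \<omega> - X_at \<rho>' \<omega>))) < ereal \<delta>}"
      using fin nonneg AE_space
    proof eventually_elim
      case (elim \<omega>)
      have "ereal \<delta> \<le> (SUP t\<in>{enn2real (\<rho>' \<omega>)..}. ereal (H \<omega> \<bullet> (X t \<omega> - X_at \<rho>' \<omega>)))"
        if "\<rho>' \<omega> < \<infinity>"
      proof (rule SUP_upper2)
        have "\<omega> \<in> A" using that fin_A by blast
        then have *: "\<rho>' \<omega> = \<rho> \<omega>" "\<rho> \<omega> < \<tau> \<omega>"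
          by (auto simp: \<rho>'_def A_def)
        then show "enn2real (\<tau> \<omega>) \<in> {enn2real (\<rho>' \<omega>)..}"
          using elim(1) by (auto intro: enn2real_mono)
        \<comment> \<open>At \<open>\<rho>\<close> the gain is at most \<open>- \<delta>\<close> and
          at \<open>\<tau>\<close> it is at least 0, so holding \<open>H\<close> from
          \<open>\<rho>\<close> to \<open>\<tau>\<close> earns at least
          \<open>\<delta>\<close>.\<close>
        have "\<delta> \<le> - H \<omega> \<bullet> (X_at \<rho> \<omega> - X_at \<sigma> \<omega>)"
          using debut_attained[of \<omega> ?H \<sigma> \<delta>] elim(3) that by (simp add: * \<rho>_def[symmetric])
        with elim(2) show "ereal \<delta> \<le> ereal (H \<omega> \<bullet> (X_at \<tau> \<omega> - X_at \<rho>' \<omega>))"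
          by (simp add: * inner_diff_right)
      qed
      then show ?case by (auto simp: not_less[symmetric])
    qed
    ultimately show False
      using measure_eq_0_if_AE_notin by fastforce
  qed
  \<comment> \<open>Countably many levels tending to 0 exclude all losses before
    \<open>\<tau>\<close> with a single null set.\<close>
  have "AE \<omega> in M. \<forall>n::nat. \<not> debut ?H \<sigma> (1 / Suc n) \<omega> < \<tau> \<omega>"
    unfolding AE_all_countable by (intro allI not_less) simp
  with nonneg fin show ?thesis
  proof eventually_elim
    case (elim \<omega>)
    show ?case
    proof (intro allI impI)
      fix t :: real assume t: "0 \<le> t" "\<sigma> \<omega> \<le> ennreal t" "ennreal t \<le> \<tau> \<omega>"
      show "0 \<le> H \<omega> \<bullet> (X t \<omega> - X_at \<sigma> \<omega>)"
      \<comment> \<open>The passage time argument speaks only about times strictly before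
        \<open>\<tau>\<close>; at \<open>\<tau>\<close> itself the assumed nonnegativity
        applies.\<close>
      proof (cases "ennreal t = \<tau> \<omega>")
        case True
        then have "enn2real (\<tau> \<omega>) = t" using t(1) by (metis enn2real_ennreal)
        with elim show ?thesis by simp
      next
        case False
        show ?thesis
        proof (rule ccontr)
          assume "\<not> ?thesis"
          then obtain n where n: "1 / real (Suc n) < ?H \<omega> \<bullet> (X t \<omega> - X_at \<sigma> \<omega>)"
            using reals_Archimedean[of "?H \<omega> \<bullet> (X t \<omega> - X_at \<sigma> \<omega>)"] by (auto simp: inverse_eq_divide)
          have "debut ?H \<sigma> (1 / Suc n) \<omega> \<le> ennreal t"
            by (rule debut_le) (use t n in auto)
          also have "\<dots> < \<tau> \<omega>"
            using t(3) False by simp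
          finally show False using elim by blast
        qed
      qed
    qed
  qed
qed

text \<open>Nonnegativity at all times between the two dates survives stopping at a deterministic
  time \<open>n\<close>, so the truncated strategy is 0-admissible. Outcomes with
  \<open>\<tau> \<le> n\<close> keep their terminal gain, and for some \<open>n\<close> it is
  nonzero on a non-null set of them.\<close>

lemma bounded_admissible_arbitrage:
  assumes \<sigma>: "stop_time M F \<sigma>" and \<tau>: "stop_time M F \<tau>" and le: "\<And>\<omega>. \<omega> \<in> space M \<Longrightarrow> \<sigma> \<omega> \<le> \<tau> \<omega>"
    and fin: "AE \<omega> in M. \<tau> \<omega> < \<infinity>"
    and H: "H \<in> borel_measurable (sigma_at M F \<sigma>)" "\<And>\<omega>. norm (H \<omega>) = 1"
    and path: "AE \<omega> in M. \<forall>t\<ge>0. \<sigma> \<omega> \<le> ennreal t \<longrightarrow> ennreal t \<le> \<tau> \<omega> \<longrightarrow> 0 \<le> H \<omega> \<bullet> (X t \<omega> - X_at \<sigma> \<omega>)"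
    and nonzero: "\<not> (AE \<omega> in M. H \<omega> \<bullet> (X_at \<tau> \<omega> - X_at \<sigma> \<omega>) = 0)"
  shows "\<exists>S H \<sigma> \<tau>. stop_time M F \<sigma> \<and> stop_time M F \<tau> \<and>
       bounded_time M \<sigma> \<and> bounded_time M \<tau> \<and> (\<forall>\<omega>\<in>space M. \<sigma> \<omega> \<le> \<tau> \<omega>) \<and>
       direction M F \<sigma> H \<and>
       simple_strategy M F S \<and> has_form M S H \<sigma> \<tau> \<and>
       zero_admissible M X S \<and> arbitrage M X S"
proof -
  have "\<not> (AE \<omega> in M. \<forall>n::nat. \<not> (\<tau> \<omega> \<le> ennreal n \<and> H \<omega> \<bullet> (X_at \<tau> \<omega> - X_at \<sigma> \<omega>) \<noteq> 0))"
  proof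
    assume "AE \<omega> in M. \<forall>n::nat. \<not> (\<tau> \<omega> \<le> ennreal n \<and> H \<omega> \<bullet> (X_at \<tau> \<omega> - X_at \<sigma> \<omega>) \<noteq> 0)"
    with fin have "AE \<omega> in M. H \<omega> \<bullet> (X_at \<tau> \<omega> - X_at \<sigma> \<omega>) = 0"
    proof eventually_elim
      case (elim \<omega>)
      then show ?case
        using ennreal_Ex_less_of_nat[of "\<tau> \<omega>"]
        by (auto simp: ennreal_of_nat_eq_real_of_nat intro: less_imp_le)
    qed
    with nonzero show False ..
  qed
  then obtain n :: nat where n: "\<not> (AE \<omega> in M. \<not> (\<tau> \<omega> \<le> ennreal n \<and> H \<omega> \<bullet> (X_at \<tau> \<omega> - X_at \<sigma> \<omega>) \<noteq> 0))"
    unfolding AE_all_countable by blast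
  obtain e :: "real ^ 'd" where e: "norm e = 1"
    using vector_choose_size[of 1] by auto
  define \<sigma>' where "\<sigma>' \<omega> = min (\<sigma> \<omega>) (ennreal n)" for \<omega>
  define \<tau>' where "\<tau>' \<omega> = min (\<tau> \<omega>) (ennreal n)" for \<omega>
  \<comment> \<open>Where \<open>\<sigma> > n\<close> both truncated dates are \<open>n\<close> and
    nothing is earned; the value \<open>e\<close> instead of 0 keeps \<open>H'\<close> a
    direction.\<close>
  define H' where "H' \<omega> = (if \<sigma> \<omega> \<le> ennreal n then H \<omega> else e)" for \<omega>
  have stop: "stop_time M F \<sigma>'" "stop_time M F \<tau>'"
    unfolding \<sigma>'_def \<tau>'_def by (intro stopping_time_min stopping_time_const \<sigma> \<tau>)+
  have le': "\<sigma>' \<omega> \<le> \<tau>' \<omega>" if "\<omega> \<in> space M" for \<omega>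
    unfolding \<sigma>'_def \<tau>'_def by (intro min.mono le that order_refl)
  have H': "H' \<in> borel_measurable (sigma_at M F \<sigma>')"
    unfolding \<sigma>'_def H'_def by (rule measurable_sigma_at_min_const[OF \<sigma> H(1)])
  have S: "simple_strategy M F (one_period \<sigma>' \<tau>' H')"
    by (rule simple_strategy_one_period[OF stop le' _ H'])
       (auto simp: \<tau>'_def intro!: AE_I2 min.strict_coboundedI2)
  \<comment> \<open>With \<open>t\<close> ranging over extended times, one statement gives both the
    wealth at finite times and, for \<open>t = \<infinity>\<close>, the terminal gain.\<close>
  have wealth: "AE \<omega> in M. \<forall>t. 0 \<le> H' \<omega> \<bullet> (X (enn2real (min t (\<tau>' \<omega>))) \<omega> - X (enn2real (min t (\<sigma>' \<omega>))) \<omega>)"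
    using path AE_space
  proof eventually_elim
    case (elim \<omega>)
    show ?case
    proof
      fix t :: ennreal
      show "0 \<le> H' \<omega> \<bullet> (X (enn2real (min t (\<tau>' \<omega>))) \<omega> - X (enn2real (min t (\<sigma>' \<omega>))) \<omega>)"
      proof (cases "\<sigma> \<omega> \<le> ennreal n \<and> \<sigma> \<omega> \<le> t")
        case True
        define s where "s = enn2real (min t (\<tau>' \<omega>))"
        have "min t (\<tau>' \<omega>) \<le> ennreal n"
          by (simp add: \<tau>'_def min.coboundedI2)
        then have s: "ennreal s = min t (\<tau>' \<omega>)"
          unfolding s_def by (intro ennreal_enn2real) (auto intro: le_less_trans)
        have "0 \<le> s" "\<sigma> \<omega> \<le> ennreal s" "ennreal s \<le> \<tau> \<omega>"
          using True le[OF elim(2)] unfolding s by (auto simp: s_def \<tau>'_def intro: min.coboundedI2)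
        then have "0 \<le> H \<omega> \<bullet> (X s \<omega> - X_at \<sigma> \<omega>)"
          using elim(1) by blast
        then show ?thesis
          using True by (simp add: s_def H'_def \<sigma>'_def min_absorb1 min_absorb2)
      next
        case False
        \<comment> \<open>If \<open>\<sigma>\<close> exceeds \<open>n\<close> or \<open>t\<close>,
          both dates are cut to the same value and the wealth is still 0.\<close>
        then have "min t (\<tau>' \<omega>) = min t (\<sigma>' \<omega>)"
          using le[OF elim(2)] by (auto simp: \<tau>'_def \<sigma>'_def min_def)
        then show ?thesis by simp
      qed
    qed
  qed
  have "arbitrage M X (one_period \<sigma>' \<tau>' H')"
    unfolding arbitrage_one_period[OF S]
  proof
    show "AE \<omega> in M. 0 \<le> H' \<omega> \<bullet> (X_at \<tau>' \<omega> - X_at \<sigma>' \<omega>)"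
      using wealth
    proof eventually_elim
      case (elim \<omega>)
      from elim[rule_format, of \<infinity>] show ?case by simp
    qed
    show "\<not> (AE \<omega> in M. H' \<omega> \<bullet> (X_at \<tau>' \<omega> - X_at \<sigma>' \<omega>) = 0)"
    proof
      assume "AE \<omega> in M. H' \<omega> \<bullet> (X_at \<tau>' \<omega> - X_at \<sigma>' \<omega>) = 0"
      then have "AE \<omega> in M. \<not> (\<tau> \<omega> \<le> ennreal n \<and> H \<omega> \<bullet> (X_at \<tau> \<omega> - X_at \<sigma> \<omega>) \<noteq> 0)"
        using AE_space
      proof eventually_elim
        case (elim \<omega>)
        show ?case
        proof
          assume *: "\<tau> \<omega> \<le> ennreal n \<and> H \<omega> \<bullet> (X_at \<tau> \<omega> - X_at \<sigma> \<omega>) \<noteq> 0"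
          then have "\<sigma> \<omega> \<le> ennreal n"
            using le[OF elim(2)] by (auto intro: order_trans)
          with * elim(1) show False
            by (simp add: H'_def \<sigma>'_def \<tau>'_def min_absorb1)
        qed
      qed
      with n show False ..
    qed
  qed
  moreover have "zero_admissible M X (one_period \<sigma>' \<tau>' H')"
    unfolding zero_admissible_def using wealth
    by eventually_elim (auto simp: wealth_one_period stopped_at_def intro!: INF_greatest)
  moreover have "bounded_time M \<sigma>'" "bounded_time M \<tau>'"
    unfolding bounded_time_def \<sigma>'_def \<tau>'_def by (auto intro!: exI[of _ "real n"])
  moreover have "direction M F \<sigma>' H'"
    using H' H(2) e by (simp add: direction_def H'_def)
  ultimately show ?thesis
    using stop le' S has_form_one_period by blast
qed

end

theorem theorem2p6:
  fixes M :: "'a measure"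
    and F :: "real \<Rightarrow> 'a measure"
    and X :: "real \<Rightarrow> 'a \<Rightarrow> real ^ 'd"
  assumes "stock_model M F X"
    and "right_continuous_paths M X"
  shows "(\<nexists>S. simple_strategy M F S \<and> arbitrage M X S) \<longleftrightarrow>
    no_obvious_arbitrage M F X \<and>
    (\<nexists>S H \<sigma> \<tau>. stop_time M F \<sigma> \<and> stop_time M F \<tau> \<and>
       bounded_time M \<sigma> \<and> bounded_time M \<tau> \<and> (\<forall>\<omega>\<in>space M. \<sigma> \<omega> \<le> \<tau> \<omega>) \<and>
       direction M F \<sigma> H \<and>
       simple_strategy M F S \<and> has_form M S H \<sigma> \<tau> \<and>
       zero_admissible M X S \<and> arbitrage M X S)"
    (is "?no_arb \<longleftrightarrow> ?noa \<and> \<not> ?adm")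
proof -
  interpret rc_stock_model M F X
    using assms by (simp add: rc_stock_model_def rc_stock_model_axioms_def)
  show ?thesis
  proof (intro iffI conjI)
    assume ?no_arb
    then show ?noa by (rule no_obvious_arbitrage_if_no_arbitrage)
    from \<open>?no_arb\<close> show "\<not> ?adm" by blast
  next
    assume R: "?noa \<and> \<not> ?adm"
    show ?no_arb
    proof
      assume "\<exists>S. simple_strategy M F S \<and> arbitrage M X S"
      then obtain S where S: "simple_strategy M F S" "arbitrage M X S" by blast
      have ?adm
      proof (rule arbitrage_one_periodE[OF S])
        fix \<sigma> \<tau> and H :: "'a \<Rightarrow> real ^ 'd"
        assume *: "stop_time M F \<sigma>" "stop_time M F \<tau>" "\<And>\<omega>. \<omega> \<in> space M \<Longrightarrow> \<sigma> \<omega> \<le> \<tau> \<omega>"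
          "AE \<omega> in M. \<tau> \<omega> < \<infinity>" "H \<in> borel_measurable (sigma_at M F \<sigma>)" "\<And>\<omega>. norm (H \<omega>) = 1"
          and nonneg: "AE \<omega> in M. 0 \<le> H \<omega> \<bullet> (X_at \<tau> \<omega> - X_at \<sigma> \<omega>)"
          and nonzero: "\<not> (AE \<omega> in M. H \<omega> \<bullet> (X_at \<tau> \<omega> - X_at \<sigma> \<omega>) = 0)"
        show ?adm
          by (rule bounded_admissible_arbitrage[OF *
                AE_increment_nonneg[OF conjunct1[OF R] *(1,2,4,5,6) nonneg] nonzero])
      qed
      with R show False by (rule notE[OF conjunct2])
    qed
  qed
qed

end
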